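(* Let $\Phi$ and $\Psi$ be set compositions of $[n]$ and $[m]$ respectively. Then in $\mathrm{NCQSym}$ $$P_\Phi P_\Psi=\sum_{\Upsilon\in\Phi\mathbin{\sqcup\!\sqcup}\Psi^{\uparrow n}}P_\Upsilon .$$
   Context: A set composition of $[n]$ is an ordered list $\Phi=(B_1,\dots,B_k)=B_1|\cdots|B_k$ of disjoint nonempty sets with union $[n]$. $\mathrm{NCQSym}$ (over $\mathbb{Q}$) has basis $M_\Phi=\sum x_{a_1}\cdots x_{a_n}$ in noncommuting variables $x_1,x_2,\dots$, over all words $(a_1,\dots,a_n)$ of positive integers with exactly $k$ distinct letters such that $B_j=\{i:a_i\text{ is the }j\text{-th smallest distinct letter}\}$; the product is that of formal power series in noncommuting variables. $\Psi^{\uparrow n}$ is obtained from $\Psi$ by adding $n$ to every element of every block. The shuffle of two lists of disjoint sets is defined recursively by $\emptyset\mathbin{\sqcup\!\sqcup} L=L\mathbin{\sqcup\!\sqcup}\emptyset=\{L\}$ and $(B_1,\dots,B_j)\mathbin{\sqcup\!\sqcup}(A_1,\dots,A_k)=B_1|[(B_2,\dots,B_j)\mathbin{\sqcup\!\sqcup}(A_1,\dots,A_k)]+A_1|[(B_1,\dots,B_j)\mathbin{\sqcup\!\sqcup}(A_2,\dots,A_k)]$, where $|$ is concatenation and $+$ is disjoint union; each element of $\Phi\mathbin{\sqcup\!\sqcup}\Psi^{\uparrow n}$ is a set composition of $[n+m]$. For disjoint nonempty sets of positive integers, $A>_{\widetilde{D}}B$ if and only if $|A|>|B|$, or $|A|=|B|$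 and $\min(A)<\min(B)$. For $\Phi=(B_1,\dots,B_k)$, $P_\Phi=\sum_{\Theta} M_\Theta$, the sum over all set compositions $\Theta$ obtained from $\Phi$ by choosing a subset $I$ of $\{i<k: B_i>_{\widetilde D}B_{i+1}\}$ and merging (by union) $B_i$ and $B_{i+1}$ into the same block for every $i\in I$. For example $P_{14|2|3}=M_{14|2|3}+M_{124|3}+M_{14|23}+M_{1234}$. *)

theory Defs
  imports Complex_Main
begin

text \<open>
  Formal power series with rational coefficients in noncommuting variables
  \<open>x\<^sub>a\<close>, given by the coefficient of each word. The words are lists
  over \<open>nat\<close>; only the variables with \<open>a \<ge> 1\<close> occur in the
  series \<open>M\<close> and \<open>P\<close> below.
\<close>

typedef ncps = "UNIV :: (nat list \<Rightarrow> rat) set"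
  morphisms coeff Abs_ncps ..

setup_lifting type_definition_ncps

lemma ncps_eqI: "(\<And>w. coeff f w = coeff g w) \<Longrightarrow> f = g"
  by transfer auto

instantiation ncps :: ring_1
begin

lift_definition zero_ncps :: ncps is "\<lambda>w. 0" .
lift_definition one_ncps :: ncps is "\<lambda>w. if w = [] then 1 else 0" .
lift_definition plus_ncps :: "ncps \<Rightarrow> ncps \<Rightarrow> ncps" is "\<lambda>f g w. f w + g w" .
lift_definition uminus_ncps :: "ncps \<Rightarrow> ncps" is "\<lambda>f w. - f w" .
lift_definition minus_ncps :: "ncps \<Rightarrow> ncps \<Rightarrow> ncps" is "\<lambda>f g w. f w - g w" .
lift_definition times_ncps :: "ncps \<Rightarrow> ncps \<Rightarrow> ncps" is
  "\<lambda>f g w. \<Sum>i\<le>length w. f (take i w) * g (drop i w)" .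

instance
proof
  fix f g h :: ncps
  show "f + g + h = f + (g + h)" "f + g = g + f" "0 + f = f" "- f + f = 0" "f - g = f + - g"
    by (transfer; simp add: fun_eq_iff algebra_simps)+
  show "(f + g) * h = f * h + g * h" "f * (g + h) = f * g + f * h"
    by (transfer; simp add: fun_eq_iff algebra_simps sum.distrib)+
  show "(0::ncps) \<noteq> 1"
    by transfer (auto simp: fun_eq_iff)
  show "1 * f = f"
  proof (transfer, rule ext)
    fix f :: "nat list \<Rightarrow> rat" and w :: "nat list"
    have "(\<Sum>i\<le>length w. (if take i w = [] then 1 else 0) * f (drop i w))
        = (\<Sum>i\<le>length w. if i = 0 then f (drop i w) else 0)"
      by (intro sum.cong) auto
    then show "(\<Sum>i\<le>length w. (if take i w = [] then 1 else 0) * f (drop i w)) = f w"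
      by simp
  qed
  show "f * 1 = f"
  proof (transfer, rule ext)
    fix f :: "nat list \<Rightarrow> rat" and w :: "nat list"
    have "(\<Sum>i\<le>length w. f (take i w) * (if drop i w = [] then 1 else 0))
        = (\<Sum>i\<le>length w. if i = length w then f (take i w) else 0)"
      by (intro sum.cong) auto
    then show "(\<Sum>i\<le>length w. f (take i w) * (if drop i w = [] then 1 else 0)) = f w"
      by simp
  qed
  show "f * g * h = f * (g * h)"
  proof (transfer, rule ext)
    fix f g h :: "nat list \<Rightarrow> rat" and w :: "nat list"
    let ?n = "length w"
    have "(\<Sum>i\<le>?n. (\<Sum>j\<le>length (take i w). f (take j (take i w)) * g (drop j (take i w)))
            * h (drop i w))
        = (\<Sum>i\<le>?n. \<Sum>j\<le>i. f (take j w) * g (drop j (take i w)) * h (drop i w))"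
      by (intro sum.cong refl) (auto simp: sum_distrib_right min_def intro!: sum.cong)
    also have "\<dots> = (\<Sum>(i,j)\<in>(SIGMA i:{..?n}. {..i}).
        f (take j w) * g (drop j (take i w)) * h (drop i w))"
      by (simp add: sum.Sigma)
    also have "\<dots> = (\<Sum>(j,k)\<in>(SIGMA j:{..?n}. {..?n - j}).
        f (take j w) * (g (take k (drop j w)) * h (drop k (drop j w))))"
      by (rule sum.reindex_bij_witness
            [of _ "\<lambda>(j,k). (j + k, j)" "\<lambda>(i,j). (j, i - j)"])
         (auto simp: drop_take mult.assoc)
    also have "\<dots> = (\<Sum>j\<le>?n. \<Sum>k\<le>?n - j.
        f (take j w) * (g (take k (drop j w)) * h (drop k (drop j w))))"
      by (simp add: sum.Sigma)
    also have "\<dots> = (\<Sum>j\<le>?n. f (take j w) *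
        (\<Sum>k\<le>length (drop j w). g (take k (drop j w)) * h (drop k (drop j w))))"
      by (simp add: sum_distrib_left)
    finally show "(\<Sum>i\<le>?n. (\<Sum>j\<le>length (take i w).
            f (take j (take i w)) * g (drop j (take i w))) * h (drop i w))
        = (\<Sum>j\<le>?n. f (take j w) *
        (\<Sum>k\<le>length (drop j w). g (take k (drop j w)) * h (drop k (drop j w))))" .
  qed
qed

end

definition set_composition :: "nat \<Rightarrow> nat set list \<Rightarrow> bool" where
  "set_composition n \<Phi> \<longleftrightarrow>
     {} \<notin> set \<Phi> \<and> sorted_wrt disjnt \<Phi> \<and> \<Union> (set \<Phi>) = {1..n}"

text \<open>
  The \<open>j\<close>-th block consists of the positions, counted from 1, of the
  \<open>j\<close>-th smallest distinct letter of \<open>w\<close>.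
\<close>

definition word_blocks :: "nat list \<Rightarrow> nat set list" where
  "word_blocks w =
     map (\<lambda>a. {i \<in> {1..length w}. w ! (i - 1) = a}) (sorted_list_of_set (set w))"

lift_definition M :: "nat set list \<Rightarrow> ncps" is
  "\<lambda>\<Phi> w. if (\<forall>a\<in>set w. 1 \<le> a) \<and> word_blocks w = \<Phi> then 1 else 0" .

lift_definition scale :: "rat \<Rightarrow> ncps \<Rightarrow> ncps" is "\<lambda>c f w. c * f w" .

interpretation ncps: vector_space scale
  by unfold_locales (transfer; simp add: fun_eq_iff algebra_simps)+

definition NCQSym :: "ncps set" where
  "NCQSym = ncps.span {M \<Phi> |\<Phi> n. set_composition n \<Phi>}"

definition greater_D :: "nat set \<Rightarrow> nat set \<Rightarrow> bool" where
  "greater_D A B \<longleftrightarrow> card A > card B \<or> card A = card B \<and> Min A < Min B"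

definition descents :: "nat set list \<Rightarrow> nat set" where
  "descents \<Phi> = {i. Suc i < length \<Phi> \<and> greater_D (\<Phi> ! i) (\<Phi> ! Suc i)}"

text \<open>
  \<open>merge I \<Phi>\<close> joins the blocks \<open>\<Phi> ! i\<close> and \<open>\<Phi> ! Suc i\<close> for every
  \<open>i \<in> I\<close> (indices from 0); runs of consecutive indices join several blocks.
\<close>

fun merge :: "nat set \<Rightarrow> nat set list \<Rightarrow> nat set list" where
  "merge I [] = []"
| "merge I [B] = [B]"
| "merge I (B # C # Bs) =
     (if 0 \<in> I then merge {i. Suc i \<in> I} ((B \<union> C) # Bs)
      else B # merge {i. Suc i \<in> I} (C # Bs))"

definition P :: "nat set list \<Rightarrow> ncps" where
  "P \<Phi> = (\<Sum>\<Theta> \<in> (\<lambda>I. merge I \<Phi>) ` Pow (descents \<Phi>). M \<Theta>)"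

definition shift :: "nat \<Rightarrow> nat set list \<Rightarrow> nat set list" where
  "shift n \<Psi> = map (\<lambda>B. (\<lambda>b. b + n) ` B) \<Psi>"

lemma Union_merge: "\<Union> (set (merge I \<Phi>)) = \<Union> (set \<Phi>)"
  by (induction I \<Phi> rule: merge.induct) (simp_all add: Un_assoc)

lemma empty_notin_merge: "{} \<notin> set \<Phi> \<Longrightarrow> {} \<notin> set (merge I \<Phi>)"
  by (induction I \<Phi> rule: merge.induct) auto

lemma sorted_wrt_disjnt_Cons:
  "sorted_wrt disjnt (B # Bs) \<longleftrightarrow> disjnt B (\<Union> (set Bs)) \<and> sorted_wrt disjnt Bs"
  by simp

lemma sorted_wrt_disjnt_merge: "sorted_wrt disjnt \<Phi> \<Longrightarrow> sorted_wrt disjnt (merge I \<Phi>)"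
proof (induction I \<Phi> rule: merge.induct)
  case (3 I B C Bs)
  then show ?case
    by (simp add: sorted_wrt_disjnt_Cons Union_merge del: sorted_wrt.simps)
qed simp_all

lemma set_composition_merge:
  "set_composition n \<Phi> \<Longrightarrow> set_composition n (merge I \<Phi>)"
  by (simp add: set_composition_def Union_merge empty_notin_merge sorted_wrt_disjnt_merge)

lemma P_in_NCQSym:
  assumes "set_composition n \<Phi>"
  shows "P \<Phi> \<in> NCQSym"
  unfolding P_def NCQSym_def
  by (intro ncps.span_sum ncps.span_base) (auto intro: set_composition_merge[OF assms])

lemma P_example:
  "P [{1,4},{2},{3}] =
     M [{1,4},{2},{3}] + M [{1,2,4},{3}] + M [{1,4},{2,3}] + M [{1,2,3,4}]"
proof -
  have "descents [{1,4},{2},{3}] = {0, 1}"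
  proof -
    have "i \<in> descents [{1,4},{2},{3}] \<longleftrightarrow> i \<in> {0, 1}" for i
    proof (cases "i = 0 \<or> i = 1")
      case True
      then show ?thesis by (auto simp: descents_def greater_D_def)
    qed (auto simp: descents_def)
    then show ?thesis by blast
  qed
  moreover have "Pow {0, 1::nat} = {{}, {0}, {1}, {0,1}}"
    by (auto simp: Pow_insert)
  ultimately have "(\<lambda>I. merge I [{1,4},{2},{3}]) ` Pow (descents [{1,4},{2},{3}]) =
      {[{1,4},{2},{3}], [{1,2,4},{3}], [{1,4},{2,3}], [{1,2,3,4}]}"
    by (simp add: insert_commute)
  moreover have "{1,4} \<noteq> {1,2,4::nat}"
  proof -
    have "2 \<in> {1,2,4::nat}" "2 \<notin> {1,4::nat}" by simp_all
    then show ?thesis by metis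
  qed
  ultimately show ?thesis
    by (simp add: P_def add.assoc)
qed

text \<open>
  The library constant \<^const>\<open>shuffles\<close> collects the shuffles of two lists in a
  set, by the usual recursion on the first elements. No multiplicities are lost when it
  is applied to \<open>\<Phi>\<close> and \<open>shift n \<Psi>\<close>: the blocks of the two lists are disjoint
  and nonempty, so the unions in the recursion are disjoint.
\<close>

end

theory Submission
  imports Defs
begin

text \<open>
  Read a word \<open>w\<close> of length \<open>n\<close> as the function sending the position \<open>i\<close> to the \<open>i\<close>-th
  letter. As in the theory of \<open>P\<close>-partitions, \<open>w\<close> occurs in \<open>P \<Phi>\<close> (with coefficient 1) iff
  this function is constant on every block of \<open>\<Phi>\<close>, weakly increasing along \<open>\<Phi>\<close>, and strictly
  increasing wherever \<open>\<Phi>\<close> has no descent. Because \<open>greater_D\<close> is transitive, the last two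
  conditions say that \<open>\<Phi>\<close> is sorted with respect to the lexicographic order that compares
  first the letter and then, reversed, the order \<open>greater_D\<close>. On disjoint nonempty blocks this
  order is total, so two lists have exactly one sorted shuffle if both of them are sorted, and
  none otherwise. Comparing the coefficients of \<open>w\<close> gives the product rule.
\<close>

subsection \<open>Sorted lists and shuffles\<close>

text \<open>The head of each list precedes the rest of that list, so distinct heads would precede
  each other. Asymmetry also keeps each head out of its tail, which makes the tails equal as
  sets.\<close>

lemma sorted_wrt_unique:
  assumes "asymp_on (set xs) R" "sorted_wrt R xs" "sorted_wrt R ys" "set xs = set ys"
  shows "xs = ys"
  using assms
proof (induction xs arbitrary: ys)
  case (Cons x xs)
  from Cons.prems(4) obtain y ys' where ys: "ys = y # ys'"
    by (cases ys) auto
  have set: "insert x (set xs) = insert y (set ys')"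
    using Cons.prems(4) ys by simp
  have less: "\<And>z. z \<in> set xs \<Longrightarrow> R x z" "\<And>z. z \<in> set ys' \<Longrightarrow> R y z"
    using Cons.prems(2,3) ys by simp_all
  have asym: "\<not> (R u v \<and> R v u)" if "u \<in> insert x (set xs)" "v \<in> insert x (set xs)" for u v
    using asymp_onD[OF Cons.prems(1)] that unfolding list.set by blast
  have eq: "x = y"
  proof (rule ccontr)
    assume "x \<noteq> y"
    moreover have "x \<in> insert y (set ys')" "y \<in> insert x (set xs)"
      by (metis set insertI1)+
    ultimately have "R x y \<and> R y x"
      using less by simp
    with asym[OF insertI1 \<open>y \<in> insert x (set xs)\<close>] show False by contradiction
  qed
  have "x \<notin> set xs" "y \<notin> set ys'"
    using less asym[of x x] eq by auto
  then have "set xs = set ys'"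
    using set eq insert_ident by metis
  moreover have "asymp_on (set xs) R"
    using Cons.prems(1) by (rule asymp_on_subset) auto
  ultimately have "xs = ys'"
    using Cons.prems(2,3) ys by (intro Cons.IH) simp_all
  with ys eq show ?case by simp
qed simp

text \<open>Serves for the symmetric relation \<open>disjnt\<close>: mixed pairs are related both
  ways, so any order of them in the shuffle is fine.\<close>

lemma sorted_wrt_shuffle:
  assumes "zs \<in> shuffles xs ys" "sorted_wrt R xs" "sorted_wrt R ys"
    and "\<And>x y. x \<in> set xs \<Longrightarrow> y \<in> set ys \<Longrightarrow> R x y \<and> R y x"
  shows "sorted_wrt R zs"
  using assms
proof (induction xs ys arbitrary: zs rule: shuffles.induct)
  case (3 x xs y ys)
  from "3.prems"(1) consider
    zs' where "zs = x # zs'" "zs' \<in> shuffles xs (y # ys)" |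
    zs' where "zs = y # zs'" "zs' \<in> shuffles (x # xs) ys"
    by auto
  then show ?case
  proof cases
    case 1
    have "sorted_wrt R zs'"
      by (rule "3.IH"(1)[OF 1(2)]) (use "3.prems" in auto)
    moreover have "R x z" if "z \<in> set zs'" for z
      using that "3.prems" set_shuffles[OF 1(2)] by auto
    ultimately show ?thesis using 1 by simp
  next
    case 2
    have "sorted_wrt R zs'"
      by (rule "3.IH"(2)[OF 2(2)]) (use "3.prems" in auto)
    moreover have "R y z" if "z \<in> set zs'" for z
      using that "3.prems" set_shuffles[OF 2(2)] by auto
    ultimately show ?thesis using 2 by simp
  qed
qed simp_all

lemma sorted_wrt_shuffleD:
  assumes "zs \<in> shuffles xs ys" "sorted_wrt R zs"
  shows "sorted_wrt R xs \<and> sorted_wrt R ys"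
  using assms
proof (induction xs ys arbitrary: zs rule: shuffles.induct)
  case (3 x xs y ys)
  from "3.prems"(1) consider
    zs' where "zs = x # zs'" "zs' \<in> shuffles xs (y # ys)" |
    zs' where "zs = y # zs'" "zs' \<in> shuffles (x # xs) ys"
    by auto
  then show ?case
  proof cases
    case 1
    with "3.IH"(1)[OF 1(2)] "3.prems"(2) set_shuffles[OF 1(2)] show ?thesis by auto
  next
    case 2
    with "3.IH"(2)[OF 2(2)] "3.prems"(2) set_shuffles[OF 2(2)] show ?thesis by auto
  qed
qed simp_all

text \<open>This is the merge step of merge sort: the \<open>R\<close>-smaller head goes first, and
  transitivity puts it before the rest of the other list.\<close>

lemma ex_sorted_wrt_shuffle:
  assumes "transp R" "sorted_wrt R xs" "sorted_wrt R ys"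
    and "\<And>x y. x \<in> set xs \<Longrightarrow> y \<in> set ys \<Longrightarrow> R x y \<or> R y x"
  shows "\<exists>zs \<in> shuffles xs ys. sorted_wrt R zs"
  using assms(2-)
proof (induction xs ys rule: shuffles.induct)
  case (3 x xs y ys)
  show ?case
  proof (cases "R x y")
    case True
    have "\<exists>zs \<in> shuffles xs (y # ys). sorted_wrt R zs"
      by (rule "3.IH"(1)) (use "3.prems" in auto)
    then obtain zs where zs: "zs \<in> shuffles xs (y # ys)" "sorted_wrt R zs" by blast
    have "R x z" if "z \<in> set zs" for z
      using that "3.prems" True set_shuffles[OF zs(1)] transpD[OF assms(1), of x y z] by auto
    with zs show ?thesis by (intro bexI[of _ "x # zs"]) auto
  next
    case False
    then have "R y x" using "3.prems"(3) by auto
    have "\<exists>zs \<in> shuffles (x # xs) ys. sorted_wrt R zs"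
      by (rule "3.IH"(2)) (use "3.prems" in auto)
    then obtain zs where zs: "zs \<in> shuffles (x # xs) ys" "sorted_wrt R zs" by blast
    have "R y z" if "z \<in> set zs" for z
      using that "3.prems" \<open>R y x\<close> set_shuffles[OF zs(1)] transpD[OF assms(1), of y x z] by auto
    with zs show ?thesis by (intro bexI[of _ "y # zs"]) auto
  qed
qed simp_all

text \<open>Merging supplies a sorted shuffle; all shuffles have the same elements, so
  \<open>sorted_wrt_unique\<close> allows no second one. If one of the lists is unsorted, every
  shuffle inherits its disorder.\<close>

lemma sum_sorted_wrt_shuffles:
  assumes "transp R" "asymp R"
    and "\<And>x y. x \<in> set xs \<Longrightarrow> y \<in> set ys \<Longrightarrow> R x y \<or> R y x"
  shows "(\<Sum>zs \<in> shuffles xs ys. of_bool (sorted_wrt R zs)) =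
    (of_bool (sorted_wrt R xs \<and> sorted_wrt R ys) :: 'a :: semiring_1)"
proof (cases "sorted_wrt R xs \<and> sorted_wrt R ys")
  case True
  then obtain zs where zs: "zs \<in> shuffles xs ys" "sorted_wrt R zs"
    using ex_sorted_wrt_shuffle[OF assms(1) _ _ assms(3)] by blast
  have "us = zs" if "us \<in> shuffles xs ys" "sorted_wrt R us" for us
    using that zs asymp_on_subset[OF assms(2)]
    by (intro sorted_wrt_unique[of us R zs]) (simp_all add: set_shuffles)
  with zs have "sorted_wrt R us \<longleftrightarrow> us = zs" if "us \<in> shuffles xs ys" for us
    using that by blast
  then have "(\<Sum>us \<in> shuffles xs ys. of_bool (sorted_wrt R us)) =
      (\<Sum>us \<in> shuffles xs ys. if us = zs then 1 else 0 :: 'a)"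
    by (intro sum.cong) auto
  with zs True show ?thesis by simp
next
  case False
  have "of_bool (sorted_wrt R zs) = (0 :: 'a)" if "zs \<in> shuffles xs ys" for zs
    using False sorted_wrt_shuffleD[OF that, of R] by auto
  with False show ?thesis by simp
qed

subsection \<open>Level sets\<close>

definition const_on :: "(nat \<Rightarrow> nat) \<Rightarrow> nat set \<Rightarrow> bool" where
  "const_on f B \<longleftrightarrow> (\<forall>x\<in>B. \<forall>y\<in>B. f x = f y)"

text \<open>The list of nonempty fibers of \<open>f\<close> on the union, by increasing value:
  strict growth between blocks forces each block to be a whole fiber.\<close>

definition fiber_list :: "(nat \<Rightarrow> nat) \<Rightarrow> nat set list \<Rightarrow> bool" where
  "fiber_list f \<Theta> \<longleftrightarrow> {} \<notin> set \<Theta> \<and> (\<forall>B \<in> set \<Theta>. const_on f B) \<and>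
     sorted_wrt (\<lambda>X Y. \<forall>x\<in>X. \<forall>y\<in>Y. f x < f y) \<Theta>"

lemma const_onD: "const_on f B \<Longrightarrow> x \<in> B \<Longrightarrow> y \<in> B \<Longrightarrow> f x = f y"
  unfolding const_on_def by blast

lemma fiber_list_Cons:
  "fiber_list f (B # \<Theta>) \<longleftrightarrow>
     B \<noteq> {} \<and> const_on f B \<and> (\<forall>C \<in> set \<Theta>. \<forall>x\<in>B. \<forall>y\<in>C. f x < f y) \<and> fiber_list f \<Theta>"
  by (auto simp: fiber_list_def)

text \<open>Recovers the blocks from \<open>f\<close> and the union alone, on which the uniqueness
  below rests.\<close>

lemma set_fiber_list:
  assumes "fiber_list f \<Theta>"
  shows "set \<Theta> = (\<lambda>x. {y \<in> \<Union> (set \<Theta>). f y = f x}) ` \<Union> (set \<Theta>)"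
  using assms
proof (induction \<Theta>)
  case (Cons B \<Theta>)
  let ?U = "\<Union> (set \<Theta>)"
  have less: "f x < f y" if "x \<in> B" "y \<in> ?U" for x y
    using Cons.prems that by (auto simp: fiber_list_Cons)
  have "f y = f x \<longleftrightarrow> y \<in> B" if "x \<in> B" "y \<in> B \<union> ?U" for x y
  proof (cases "y \<in> B")
    case True
    with Cons.prems that(1) const_onD[of f B y x] show ?thesis by (simp add: fiber_list_Cons)
  next
    case False
    with that less[of x y] show ?thesis by auto
  qed
  then have "{y \<in> B \<union> ?U. f y = f x} = B" if "x \<in> B" for x
    using that by blast
  moreover have "B \<noteq> {}"
    using Cons.prems by (simp add: fiber_list_Cons)
  ultimately have "(\<lambda>x. {y \<in> B \<union> ?U. f y = f x}) ` B = {B}"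
    by (simp add: image_constant_conv)
  moreover have "f y \<noteq> f x" if "y \<in> B" "x \<in> ?U" for x y
    using less[OF that] by simp
  then have "{y \<in> B \<union> ?U. f y = f x} = {y \<in> ?U. f y = f x}" if "x \<in> ?U" for x
    using that by blast
  then have "(\<lambda>x. {y \<in> B \<union> ?U. f y = f x}) ` ?U = (\<lambda>x. {y \<in> ?U. f y = f x}) ` ?U"
    by (rule image_cong[OF refl])
  then have "(\<lambda>x. {y \<in> B \<union> ?U. f y = f x}) ` ?U = set \<Theta>"
    using Cons.IH Cons.prems unfolding fiber_list_Cons by (metis (lifting))
  ultimately have "(\<lambda>x. {y \<in> B \<union> ?U. f y = f x}) ` (B \<union> ?U) = insert B (set \<Theta>)"
    unfolding image_Un by simp
  then show ?case by simp
qed simp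

lemma fiber_list_unique:
  assumes "fiber_list f \<Theta>" "fiber_list f \<Theta>'" "\<Union> (set \<Theta>) = \<Union> (set \<Theta>')"
  shows "\<Theta> = \<Theta>'"
proof (rule sorted_wrt_unique)
  show "set \<Theta> = set \<Theta>'"
    using set_fiber_list[OF assms(1)] unfolding assms(3) set_fiber_list[OF assms(2), symmetric] .
next
  show "asymp_on (set \<Theta>) (\<lambda>X Y. \<forall>x\<in>X. \<forall>y\<in>Y. f x < f y)"
  proof (rule asymp_onI)
    fix X Y assume "X \<in> set \<Theta>" "Y \<in> set \<Theta>" and less: "\<forall>x\<in>X. \<forall>y\<in>Y. f x < f y"
    \<comment> \<open>Witnesses from nonempty blocks matter here: the relation holds vacuously for
      an empty set.\<close>
    with assms(1) obtain x y where xy: "x \<in> X" "y \<in> Y"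
      by (fastforce simp: fiber_list_def)
    with less have "\<not> f y < f x" by (simp add: less_imp_not_less)
    with xy show "\<not> (\<forall>x\<in>Y. \<forall>y\<in>X. f x < f y)" by blast
  qed
qed (use assms in \<open>simp_all add: fiber_list_def\<close>)

text \<open>Positions count from 1, list indices from 0. Blocks of a set composition never contain
  0, where truncated subtraction would yield \<open>w ! 0\<close>.\<close>

abbreviation letter :: "nat list \<Rightarrow> nat \<Rightarrow> nat" where
  "letter w i \<equiv> w ! (i - 1)"

lemma fiber_list_word_blocks: "fiber_list (letter w) (word_blocks w)"
proof -
  have "{i \<in> {1..length w}. letter w i = a} \<noteq> {}" if "a \<in> set w" for a
  proof -
    from that obtain j where "j < length w" "w ! j = a" by (auto simp: in_set_conv_nth)
    then have "Suc j \<in> {i \<in> {1..length w}. letter w i = a}" by simp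
    then show ?thesis by blast
  qed
  moreover have "sorted_wrt (\<lambda>X Y. \<forall>x\<in>X. \<forall>y\<in>Y. letter w x < letter w y) (word_blocks w)"
    unfolding word_blocks_def sorted_wrt_map
    by (rule sorted_wrt_mono_rel[OF _ strict_sorted_list_of_set]) auto
  ultimately show ?thesis
    by (fastforce simp: fiber_list_def word_blocks_def const_on_def)
qed

lemma Union_word_blocks: "\<Union> (set (word_blocks w)) = {1..length w}"
  by (auto simp: word_blocks_def)

text \<open>Replaces the computed level sets by a condition on \<open>w\<close> that can be followed
  through merging.\<close>

lemma word_blocks_eq_iff:
  assumes "\<Union> (set \<Theta>) = {1..n}"
  shows "word_blocks w = \<Theta> \<longleftrightarrow> length w = n \<and> fiber_list (letter w) \<Theta>"
proof
  assume *: "word_blocks w = \<Theta>"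
  then have "{1..length w} = {1..n}"
    using assms Union_word_blocks[of w] by metis
  \<comment> \<open>Cardinalities settle \<open>n = 0\<close> as well, where the intervals are
    empty.\<close>
  then have "card {1..length w} = card {1..n}"
    by (rule arg_cong)
  then have "length w = n"
    by simp
  with * fiber_list_word_blocks[of w] show "length w = n \<and> fiber_list (letter w) \<Theta>" by simp
next
  assume "length w = n \<and> fiber_list (letter w) \<Theta>"
  then show "word_blocks w = \<Theta>"
    using fiber_list_unique[OF fiber_list_word_blocks] Union_word_blocks assms by simp
qed

subsection \<open>Coefficients of \<open>P\<close>\<close>

text \<open>The letter of a block is read at its minimum, so this is a lexicographic comparison of
  all sets: smaller \<open>f (Min B)\<close>, then larger \<open>card B\<close>, then smaller
  \<open>Min B\<close>. Constancy on blocks is kept apart as \<open>const_on\<close>.\<close>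

definition block_less :: "(nat \<Rightarrow> nat) \<Rightarrow> nat set \<Rightarrow> nat set \<Rightarrow> bool" where
  "block_less f B C \<longleftrightarrow>
     f (Min B) < f (Min C) \<or> f (Min B) = f (Min C) \<and> greater_D B C"

lemma transp_block_less: "transp (block_less f)"
  by (rule transpI) (auto simp: block_less_def greater_D_def)

lemma asymp_block_less: "asymp (block_less f)"
  by (rule asympI) (auto simp: block_less_def greater_D_def)

text \<open>Disjoint nonempty finite sets have different minima, which breaks every remaining
  tie.\<close>

lemma block_less_total:
  assumes "finite B" "finite C" "B \<noteq> {}" "C \<noteq> {}" "disjnt B C"
  shows "block_less f B C \<or> block_less f C B"
proof -
  have "Min B \<noteq> Min C"
    using Min_in[OF assms(1,3)] Min_in[OF assms(2,4)] assms(5) by (auto simp: disjnt_iff)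
  then show ?thesis
    by (auto simp: block_less_def greater_D_def)
qed

text \<open>Unlike in the recursive equation, the head block here is joined after the rest of the
  list has been merged, so that the induction over the list leaves the tail unchanged.\<close>

lemma merge_Un_Cons:
  "merge I ((B \<union> C) # Bs) = (B \<union> hd (merge I (C # Bs))) # tl (merge I (C # Bs))"
proof (induction Bs arbitrary: I C)
  case (Cons D Bs)
  then show ?case
    using Cons.IH[of "{i. Suc i \<in> I}" "C \<union> D"] by (simp add: Un_assoc)
qed simp

text \<open>Joining \<open>C\<close> to itself changes nothing, so \<open>merge_Un_Cons\<close>
  exhibits the merged list as a cons whose head contains \<open>C\<close>.\<close>

lemma merge_Cons_neq_Nil: "merge I (C # Bs) \<noteq> []"
  using merge_Un_Cons[of I C C Bs] by (metis Un_absorb list.distinct(1))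

lemma subset_hd_merge: "C \<subseteq> hd (merge I (C # Bs))"
  using merge_Un_Cons[of I C C Bs] by (metis Un_absorb Un_upper1 list.sel(1))

lemma descents_Cons_Cons:
  "I \<subseteq> descents (B # C # Bs) \<longleftrightarrow>
     (0 \<in> I \<longrightarrow> greater_D B C) \<and> {i. Suc i \<in> I} \<subseteq> descents (C # Bs)"
proof -
  have "i \<in> descents (B # C # Bs) \<longleftrightarrow>
      (case i of 0 \<Rightarrow> greater_D B C | Suc j \<Rightarrow> j \<in> descents (C # Bs))" for i
    by (cases i) (auto simp: descents_def)
  then show ?thesis
    unfolding subset_iff by (metis (no_types, lifting) mem_Collect_eq nat.case not0_implies_Suc)
qed

text \<open>A choice for the longer list is a choice for its tail plus a decision at index 0. By
  \<open>merge_Un_Cons\<close>, both decisions refer to the same merged tail.\<close>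

lemma ex_merge_Cons:
  "(\<exists>I \<subseteq> descents (B # C # Bs). Q (merge I (B # C # Bs))) \<longleftrightarrow>
   (\<exists>I \<subseteq> descents (C # Bs). let \<Theta> = merge I (C # Bs) in
      Q (B # \<Theta>) \<or> greater_D B C \<and> Q ((B \<union> hd \<Theta>) # tl \<Theta>))"
  (is "?L \<longleftrightarrow> ?R")
proof
  assume ?L
  then obtain I where I: "I \<subseteq> descents (B # C # Bs)" "Q (merge I (B # C # Bs))" by blast
  then show ?R
    by (intro exI[of _ "{i. Suc i \<in> I}"])
      (auto simp: descents_Cons_Cons merge_Un_Cons Let_def split: if_splits)
next
  assume ?R
  then obtain I where I: "I \<subseteq> descents (C # Bs)" and
    *: "Q (B # merge I (C # Bs)) \<or>
      greater_D B C \<and> Q ((B \<union> hd (merge I (C # Bs))) # tl (merge I (C # Bs)))"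
    by (auto simp: Let_def)
  \<comment> \<open>The witness is \<open>I\<close> shifted by \<open>Suc\<close>, with 0 added
    exactly when \<open>B\<close> is joined.\<close>
  from * show ?L
  proof
    assume "Q (B # merge I (C # Bs))"
    with I show ?L
      by (intro exI[of _ "Suc ` I"]) (simp add: descents_Cons_Cons image_iff)
  next
    assume "greater_D B C \<and> Q ((B \<union> hd (merge I (C # Bs))) # tl (merge I (C # Bs)))"
    with I show ?L
      by (intro exI[of _ "insert 0 (Suc ` I)"])
        (simp add: descents_Cons_Cons image_iff merge_Un_Cons)
  qed
qed

text \<open>Keeping the head block separate demands a strict increase of \<open>f\<close>; joining
  it demands equality and a descent. Together these say \<open>block_less\<close> for the first two
  blocks.\<close>

lemma ex_fiber_list_merge_iff:
  assumes "\<And>B. B \<in> set \<Phi> \<Longrightarrow> finite B \<and> B \<noteq> {}"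
  shows "(\<exists>I \<subseteq> descents \<Phi>. fiber_list f (merge I \<Phi>)) \<longleftrightarrow>
    (\<forall>B \<in> set \<Phi>. const_on f B) \<and> sorted_wrt (block_less f) \<Phi>"
  using assms
proof (induction \<Phi> rule: induct_list012)
  case 1
  then show ?case by (auto simp: fiber_list_def)
next
  case (2 B)
  then show ?case by (auto simp: fiber_list_def)
next
  case (3 B C Bs)
  have B: "Min B \<in> B" "B \<noteq> {}" and C: "Min C \<in> C" "C \<noteq> {}"
    using "3.prems" by (auto intro!: Min_in)
  \<comment> \<open>On the right only \<open>fiber_list f \<Theta>\<close> depends on
    \<open>I\<close>, so the quantifier over \<open>I\<close> passes through to the tail.\<close>
  have step: "fiber_list f (B # \<Theta>) \<or> greater_D B C \<and> fiber_list f ((B \<union> hd \<Theta>) # tl \<Theta>) \<longleftrightarrow>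
      const_on f B \<and> block_less f B C \<and> fiber_list f \<Theta>"
    if \<Theta>: "\<Theta> = merge I (C # Bs)" for \<Theta> I
  proof -
    \<comment> \<open>Since \<open>D\<close> contains \<open>C\<close>, a fiber list starting with
      \<open>D\<close> has the value \<open>f (Min C)\<close> on all of \<open>D\<close>.\<close>
    obtain D \<Delta> where D: "\<Theta> = D # \<Delta>" "C \<subseteq> D"
      using merge_Cons_neq_Nil subset_hd_merge \<Theta> by (metis list.collapse)
    have 1: "fiber_list f (B # \<Theta>) \<longleftrightarrow>
        const_on f B \<and> f (Min B) < f (Min C) \<and> fiber_list f \<Theta>"
    proof
      assume "fiber_list f (B # \<Theta>)"
      then show "const_on f B \<and> f (Min B) < f (Min C) \<and> fiber_list f \<Theta>"
        using B C D by (auto simp: fiber_list_Cons)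
    next
      assume *: "const_on f B \<and> f (Min B) < f (Min C) \<and> fiber_list f \<Theta>"
      have "f x < f y" if "x \<in> B" "y \<in> E" "E \<in> set \<Theta>" for x y E
      proof -
        have "f x = f (Min B)" using * B that const_onD[of f B] by blast
        moreover have "f (Min C) \<le> f y"
        proof (cases "E = D")
          case True
          then have "f (Min C) = f y"
            using * C D that const_onD[of f D] unfolding fiber_list_Cons D by blast
          then show ?thesis by simp
        next
          case False
          then have "f (Min C) < f y"
            using * C D that by (auto simp: fiber_list_Cons)
          then show ?thesis by simp
        qed
        ultimately show ?thesis using * by simp
      qed
      with * B show "fiber_list f (B # \<Theta>)" by (auto simp: fiber_list_Cons)
    qed
    have 2: "fiber_list f ((B \<union> hd \<Theta>) # tl \<Theta>) \<longleftrightarrow>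
        const_on f B \<and> f (Min B) = f (Min C) \<and> fiber_list f \<Theta>"
    proof
      assume *: "fiber_list f ((B \<union> hd \<Theta>) # tl \<Theta>)"
      then have "const_on f (B \<union> D)" using D by (simp add: fiber_list_Cons)
      then have "const_on f B" "const_on f D" "f (Min B) = f (Min C)"
        using B C D const_onD[of f "B \<union> D" "Min B" "Min C"]
        by (auto simp only: const_on_def Un_iff subset_iff)
      with * C D show "const_on f B \<and> f (Min B) = f (Min C) \<and> fiber_list f \<Theta>"
        by (auto simp: fiber_list_Cons)
    next
      assume *: "const_on f B \<and> f (Min B) = f (Min C) \<and> fiber_list f \<Theta>"
      have v: "f x = f (Min C)" if "x \<in> B \<union> D" for x
      proof (cases "x \<in> B")
        case True
        then have "f x = f (Min B)" using * B const_onD[of f B] by blast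
        with * show ?thesis by simp
      next
        case False
        with * that C D const_onD[of f D] show ?thesis unfolding fiber_list_Cons D by blast
      qed
      moreover from v have "const_on f (B \<union> D)" by (simp add: const_on_def)
      ultimately show "fiber_list f ((B \<union> hd \<Theta>) # tl \<Theta>)"
        using * B C D by (auto simp: fiber_list_Cons)
    qed
    show ?thesis unfolding 1 2 block_less_def by blast
  qed
  have "(\<exists>I \<subseteq> descents (B # C # Bs). fiber_list f (merge I (B # C # Bs))) \<longleftrightarrow>
      const_on f B \<and> block_less f B C \<and> (\<exists>I \<subseteq> descents (C # Bs). fiber_list f (merge I (C # Bs)))"
    unfolding ex_merge_Cons Let_def step[OF refl] by blast
  also have "(\<exists>I \<subseteq> descents (C # Bs). fiber_list f (merge I (C # Bs))) \<longleftrightarrow>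
      (\<forall>B \<in> set (C # Bs). const_on f B) \<and> sorted_wrt (block_less f) (C # Bs)"
    by (rule "3.IH") (use "3.prems" in auto)
  finally show ?case
    \<comment> \<open>Transitivity reduces sortedness to comparisons of neighbours.\<close>
    unfolding sorted_wrt2[OF transp_block_less] by auto
qed

lemma coeff_sum: "coeff (\<Sum>x\<in>A. g x) w = (\<Sum>x\<in>A. coeff (g x) w)"
  by (induction A rule: infinite_finite_induct) (simp_all add: zero_ncps.rep_eq plus_ncps.rep_eq)

lemma set_composition_block:
  assumes "set_composition n \<Phi>" "B \<in> set \<Phi>"
  shows "finite B \<and> B \<noteq> {}" "B \<subseteq> {1..n}"
proof -
  show "B \<subseteq> {1..n}" using assms by (auto simp: set_composition_def)
  then show "finite B \<and> B \<noteq> {}" using assms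
    by (auto simp: set_composition_def intro: finite_subset)
qed

text \<open>Only \<open>\<Theta> = word_blocks w\<close> can contribute, and the sum runs over a set
  of merged lists, so the coefficient is a membership test.\<close>

lemma coeff_P:
  assumes "set_composition n \<Phi>"
  shows "coeff (P \<Phi>) w = of_bool ((\<forall>a\<in>set w. 1 \<le> a) \<and> length w = n \<and>
    (\<forall>B \<in> set \<Phi>. const_on (letter w) B) \<and> sorted_wrt (block_less (letter w)) \<Phi>)"
proof -
  let ?A = "(\<lambda>I. merge I \<Phi>) ` Pow (descents \<Phi>)"
  have "finite (descents \<Phi>)"
    by (rule finite_subset[of _ "{..length \<Phi>}"]) (auto simp: descents_def)
  then have fin: "finite ?A" by simp
  have "coeff (P \<Phi>) w =
      (\<Sum>\<Theta> \<in> ?A. if word_blocks w = \<Theta> then of_bool (\<forall>a\<in>set w. 1 \<le> a) else 0)"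
    unfolding P_def coeff_sum M.rep_eq by (intro sum.cong) auto
  also have "\<dots> = of_bool ((\<forall>a\<in>set w. 1 \<le> a) \<and> word_blocks w \<in> ?A)"
    using fin by (subst sum.delta') auto
  also have "word_blocks w \<in> ?A \<longleftrightarrow> (\<exists>I \<subseteq> descents \<Phi>. word_blocks w = merge I \<Phi>)"
    by auto
  also have "\<dots> \<longleftrightarrow> length w = n \<and> (\<exists>I \<subseteq> descents \<Phi>. fiber_list (letter w) (merge I \<Phi>))"
    \<comment> \<open>Merging preserves the union, so the criterion applies to every merged list
      with the same \<open>n\<close>.\<close>
    using assms by (subst word_blocks_eq_iff[of _ n]) (auto simp: Union_merge set_composition_def)
  finally show ?thesis
    using ex_fiber_list_merge_iff[of \<Phi> "letter w"] set_composition_block[OF assms] by simp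
qed

subsection \<open>The product rule\<close>

text \<open>Translation preserves cardinalities and moves minima along, so it leaves
  \<open>greater_D\<close> unchanged.\<close>

lemma block_less_image_add:
  assumes "finite B" "finite C" "B \<noteq> {}" "C \<noteq> {}"
  shows "block_less f ((\<lambda>b. b + n) ` B) ((\<lambda>b. b + n) ` C) \<longleftrightarrow>
    block_less (\<lambda>i. f (i + n)) B C"
proof -
  have "Min ((\<lambda>b. b + n) ` X) = Min X + n" if "finite X" "X \<noteq> {}" for X
    using that by (rule mono_Min_commute[symmetric, rotated]) (simp add: mono_def)
  moreover have "card ((\<lambda>b. b + n) ` X) = card X" for X
    by (simp add: card_image)
  ultimately show ?thesis
    using assms by (simp add: block_less_def greater_D_def)
qed

lemma const_on_cong: "(\<And>x. x \<in> B \<Longrightarrow> f x = g x) \<Longrightarrow> const_on f B \<longleftrightarrow> const_on g B"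
  by (simp add: const_on_def)

lemma block_less_cong:
  assumes "finite B" "B \<noteq> {}" "finite C" "C \<noteq> {}" "\<And>x. x \<in> B \<union> C \<Longrightarrow> f x = g x"
  shows "block_less f B C \<longleftrightarrow> block_less g B C"
  using assms Min_in[of B] Min_in[of C] by (simp add: block_less_def)

lemma sorted_wrt_cong:
  assumes "\<And>x y. x \<in> set xs \<Longrightarrow> y \<in> set xs \<Longrightarrow> R x y \<longleftrightarrow> S x y"
  shows "sorted_wrt R xs \<longleftrightarrow> sorted_wrt S xs"
  using assms by (induction xs) auto

lemma disjnt_shift:
  assumes "set_composition n \<Phi>" "set_composition m \<Psi>" "B \<in> set \<Phi>" "C \<in> set (shift n \<Psi>)"
  shows "disjnt B C"
proof -
  from assms(4) obtain D where D: "D \<in> set \<Psi>" "C = (\<lambda>b. b + n) ` D"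
    by (auto simp: shift_def)
  then show ?thesis
    using set_composition_block(2)[OF assms(1,3)] set_composition_block(2)[OF assms(2) D(1)]
    by (fastforce simp: disjnt_iff)
qed

text \<open>Makes \<open>coeff_P\<close> available for every shuffle, with length
  \<open>n + m\<close>.\<close>

lemma set_composition_shuffle:
  assumes \<Phi>: "set_composition n \<Phi>" and \<Psi>: "set_composition m \<Psi>"
    and \<Upsilon>: "\<Upsilon> \<in> shuffles \<Phi> (shift n \<Psi>)"
  shows "set_composition (n + m) \<Upsilon>"
  unfolding set_composition_def
proof (intro conjI)
  show "{} \<notin> set \<Upsilon>"
    using \<Phi> \<Psi> set_shuffles[OF \<Upsilon>] by (auto simp: set_composition_def shift_def)
  have "sorted_wrt disjnt (shift n \<Psi>)"
    using \<Psi> unfolding shift_def sorted_wrt_map set_composition_def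
    by (auto simp: disjnt_iff elim!: sorted_wrt_mono_rel[rotated])
  then show "sorted_wrt disjnt \<Upsilon>"
    using \<Phi> disjnt_shift[OF \<Phi> \<Psi>]
    by (intro sorted_wrt_shuffle[OF \<Upsilon>]) (auto simp: set_composition_def disjnt_sym)
  have "\<Union> (set (shift n \<Psi>)) = (\<lambda>b. b + n) ` \<Union> (set \<Psi>)"
    by (auto simp: shift_def)
  also have "\<dots> = {1 + n..m + n}"
    using \<Psi> by (simp add: set_composition_def del: One_nat_def)
  finally show "\<Union> (set \<Upsilon>) = {1..n + m}"
    using \<Phi> set_shuffles[OF \<Upsilon>] by (auto simp: set_composition_def)
qed

text \<open>Blocks of \<open>\<Phi>\<close> see only positions up to \<open>n\<close>, where the
  prefix agrees with \<open>w\<close>.\<close>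

lemma const_on_sorted_take:
  assumes "set_composition n \<Phi>"
  shows "(\<forall>B \<in> set \<Phi>. const_on (letter (take n w)) B) \<longleftrightarrow> (\<forall>B \<in> set \<Phi>. const_on (letter w) B)"
    and "sorted_wrt (block_less (letter (take n w))) \<Phi> \<longleftrightarrow> sorted_wrt (block_less (letter w)) \<Phi>"
proof -
  have eq: "letter (take n w) x = letter w x" if "B \<in> set \<Phi>" "x \<in> B" for B x
    using set_composition_block(2)[OF assms that(1)] that(2) by (fastforce intro!: nth_take)
  show "(\<forall>B \<in> set \<Phi>. const_on (letter (take n w)) B) \<longleftrightarrow> (\<forall>B \<in> set \<Phi>. const_on (letter w) B)"
    by (intro ball_cong refl const_on_cong) (rule eq)
  show "sorted_wrt (block_less (letter (take n w))) \<Phi> \<longleftrightarrow> sorted_wrt (block_less (letter w)) \<Phi>"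
    using set_composition_block(1)[OF assms] eq
    by (intro sorted_wrt_cong block_less_cong) blast+
qed

lemma const_on_sorted_drop:
  assumes "set_composition m \<Psi>" "n \<le> length w"
  shows "(\<forall>B \<in> set \<Psi>. const_on (letter (drop n w)) B) \<longleftrightarrow>
      (\<forall>B \<in> set (shift n \<Psi>). const_on (letter w) B)"
    and "sorted_wrt (block_less (letter (drop n w))) \<Psi> \<longleftrightarrow>
      sorted_wrt (block_less (letter w)) (shift n \<Psi>)"
proof -
  \<comment> \<open>Here \<open>x \<ge> 1\<close> makes \<open>n + (x - 1)\<close> equal to
    \<open>x + n - 1\<close>.\<close>
  have eq: "letter (drop n w) x = letter w (x + n)" if "B \<in> set \<Psi>" "x \<in> B" for B x
    using set_composition_block(2)[OF assms(1) that(1)] that(2) assms(2)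
    by (auto simp: add.commute)
  have "(\<forall>B \<in> set \<Psi>. const_on (letter (drop n w)) B) \<longleftrightarrow>
      (\<forall>B \<in> set \<Psi>. const_on (\<lambda>i. letter w (i + n)) B)"
    by (intro ball_cong refl const_on_cong) (rule eq)
  then show "(\<forall>B \<in> set \<Psi>. const_on (letter (drop n w)) B) \<longleftrightarrow>
      (\<forall>B \<in> set (shift n \<Psi>). const_on (letter w) B)"
    by (simp add: shift_def const_on_def)
  have "block_less (letter (drop n w)) B C \<longleftrightarrow>
      block_less (letter w) ((\<lambda>b. b + n) ` B) ((\<lambda>b. b + n) ` C)"
    if "B \<in> set \<Psi>" "C \<in> set \<Psi>" for B C
  proof -
    have "block_less (letter (drop n w)) B C \<longleftrightarrow> block_less (\<lambda>i. letter w (i + n)) B C"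
      using that set_composition_block(1)[OF assms(1)] eq by (intro block_less_cong) blast+
    with that set_composition_block(1)[OF assms(1)] show ?thesis
      by (subst block_less_image_add) blast+
  qed
  then show "sorted_wrt (block_less (letter (drop n w))) \<Psi> \<longleftrightarrow>
      sorted_wrt (block_less (letter w)) (shift n \<Psi>)"
    unfolding shift_def sorted_wrt_map by (rule sorted_wrt_cong)
qed

theorem theorem9:
  fixes \<Phi> \<Psi> :: "nat set list" and n m :: nat
  assumes "set_composition n \<Phi>" and "set_composition m \<Psi>"
  shows "P \<Phi> * P \<Psi> = (\<Sum>\<Upsilon> \<in> shuffles \<Phi> (shift n \<Psi>). P \<Upsilon>)"
proof (rule ncps_eqI)
  fix w
  let ?R = "block_less (letter w)" and ?S = "shift n \<Psi>"
  \<comment> \<open>Collects the conditions on \<open>w\<close> shared by all shuffles; only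
    sortedness depends on the shuffle.\<close>
  define good where "good \<longleftrightarrow> (\<forall>a\<in>set w. 1 \<le> a) \<and> length w = n + m \<and>
    (\<forall>B \<in> set \<Phi> \<union> set ?S. const_on (letter w) B)"
  have "coeff (P \<Phi> * P \<Psi>) w =
      (\<Sum>i\<le>length w. coeff (P \<Phi>) (take i w) * coeff (P \<Psi>) (drop i w))"
    by (simp add: times_ncps.rep_eq)
  also have "\<dots> = (\<Sum>i\<le>length w.
      if i = n then coeff (P \<Phi>) (take n w) * coeff (P \<Psi>) (drop n w) else 0)"
    \<comment> \<open>The first factor vanishes unless the prefix has length \<open>n\<close>, so a
      single cut of \<open>w\<close> survives.\<close>
    by (intro sum.cong) (auto simp: coeff_P[OF assms(1)])
  also have "\<dots> = of_bool (n \<le> length w) * (coeff (P \<Phi>) (take n w) * coeff (P \<Psi>) (drop n w))"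
    by simp
  also have "\<dots> = of_bool (good \<and> sorted_wrt ?R \<Phi> \<and> sorted_wrt ?R ?S)"
  proof (cases "n \<le> length w")
    case True
    have "set w = set (take n w) \<union> set (drop n w)"
      by (metis append_take_drop_id set_append)
    then have "(\<forall>a\<in>set w. 1 \<le> a) \<longleftrightarrow>
        (\<forall>a\<in>set (take n w). 1 \<le> a) \<and> (\<forall>a\<in>set (drop n w). 1 \<le> a)"
      by blast
    then show ?thesis
      unfolding coeff_P[OF assms(1)] coeff_P[OF assms(2)] const_on_sorted_take[OF assms(1)]
        const_on_sorted_drop[OF assms(2) True] good_def of_bool_conj[symmetric]
      using True by (intro arg_cong[of _ _ of_bool]) auto
  \<comment> \<open>If \<open>w\<close> is shorter than \<open>n\<close>, then \<open>good\<close>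
    fails and both sides are 0.\<close>
  qed (simp add: good_def)
  also have "\<dots> = of_bool good * (\<Sum>\<Upsilon> \<in> shuffles \<Phi> ?S. of_bool (sorted_wrt ?R \<Upsilon>))"
  proof -
    have "?R B C \<or> ?R C B" if "B \<in> set \<Phi>" "C \<in> set ?S" for B C
    proof (rule block_less_total)
      show "disjnt B C" using disjnt_shift[OF assms that] .
      show "finite B" "B \<noteq> {}" using set_composition_block(1)[OF assms(1) that(1)] by auto
      show "finite C" "C \<noteq> {}" using set_composition_block(1)[OF assms(2)] that(2)
        by (auto simp: shift_def)
    qed
    then show ?thesis
      by (subst sum_sorted_wrt_shuffles[OF transp_block_less asymp_block_less]) auto
  qed
  also have "\<dots> = (\<Sum>\<Upsilon> \<in> shuffles \<Phi> ?S. coeff (P \<Upsilon>) w)"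
    unfolding sum_distrib_left
  proof (rule sum.cong)
    fix \<Upsilon> assume \<Upsilon>: "\<Upsilon> \<in> shuffles \<Phi> ?S"
    \<comment> \<open>A shuffle has exactly the blocks of both lists, so its coefficient splits into
      \<open>good\<close> and sortedness.\<close>
    show "of_bool good * of_bool (sorted_wrt ?R \<Upsilon>) = coeff (P \<Upsilon>) w"
      unfolding coeff_P[OF set_composition_shuffle[OF assms \<Upsilon>]] set_shuffles[OF \<Upsilon>] good_def
      by auto
  qed simp
  also have "\<dots> = coeff (\<Sum>\<Upsilon> \<in> shuffles \<Phi> ?S. P \<Upsilon>) w"
    by (simp add: coeff_sum)
  finally show "coeff (P \<Phi> * P \<Psi>) w = coeff (\<Sum>\<Upsilon> \<in> shuffles \<Phi> ?S. P \<Upsilon>) w" .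
qed

end
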